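(* Let $(A,\cdot,\ast,\alpha)$ be a multiplicative Hom-Novikov-Poisson algebra and let $a\in A$ be an element such that $\alpha^2(a)=a$. Then $\overline{A}=(A,\cdot_\alpha,\times,\alpha^2)$ is also a multiplicative Hom-Novikov-Poisson algebra, where \[ x\cdot_\alpha y=\alpha(x\cdot y)=\alpha(x)\cdot\alpha(y),\qquad x\times y=\alpha(x)\ast\alpha(y)+a\cdot(x\cdot y) \] for all $x,y\in A$.
   Context: Everything is over a fixed field $\mathbf{k}$ of characteristic $0$. A double Hom-algebra is a quadruple $(A,\cdot,\ast,\alpha)$ where $A$ is a $\mathbf{k}$-vector space, $\cdot$ and $\ast$ are bilinear operations $A\otimes A\to A$, and $\alpha\colon A\to A$ is a linear map (the twisting map). It is multiplicative if $\alpha(x\cdot y)=\alpha(x)\cdot\alpha(y)$ and $\alpha(x\ast y)=\alpha(x)\ast\alpha(y)$ for all $x,y$. $\alpha^n$ denotes the $n$-fold composition of $\alpha$. A Hom-Novikov-Poisson algebra is a double Hom-algebra $(A,\cdot,\ast,\alpha)$ such that for all $x,y,z\in A$: (1) $(A,\cdot,\alpha)$ is a commutative Hom-associative algebra: $x\cdot y=y\cdot x$ and $(x\cdot y)\cdot\alpha(z)=\alpha(x)\cdot(y\cdot z)$; (2) $(A,\ast,\alpha)$ is a Hom-Novikov algebra: $(x\ast y)\ast\alpha(z)-\alpha(x)\ast(y\ast z)=(y\ast x)\ast\alpha(z)-\alpha(y)\ast(x\ast z)$ and $(x\ast y)\ast\alpha(z)=(x\ast z)\ast\alpha(y)$; (3)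 $(x\ast y)\cdot\alpha(z)-\alpha(x)\ast(y\cdot z)=(y\ast x)\cdot\alpha(z)-\alpha(y)\ast(x\cdot z)$; (4) $(x\cdot y)\ast\alpha(z)=(x\ast z)\cdot\alpha(y)$. *)

theory Defs
  imports Complex_Main
begin

text \<open>
  The algebra is the whole type \<open>'a\<close>, made a vector space over a field \<open>'k\<close> of
  characteristic 0 by the scalar multiplication \<open>scale\<close>.
  The library notion of bilinearity covers real scalars only.
\<close>

definition bilinear_op ::
  "('k::field_char_0 \<Rightarrow> 'a::ab_group_add \<Rightarrow> 'a) \<Rightarrow> ('a \<Rightarrow> 'a \<Rightarrow> 'a) \<Rightarrow> bool"
  where "bilinear_op scale f \<longleftrightarrow>
    (\<forall>x. Vector_Spaces.linear scale scale (\<lambda>y. f x y)) \<and>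
    (\<forall>y. Vector_Spaces.linear scale scale (\<lambda>x. f x y))"

locale hom_algebra = vector_space scale
  for scale :: "'k::field_char_0 \<Rightarrow> 'a::ab_group_add \<Rightarrow> 'a" +
  fixes prod :: "'a \<Rightarrow> 'a \<Rightarrow> 'a" (infixl "\<bullet>" 70)
    and \<alpha> :: "'a \<Rightarrow> 'a"
  assumes bilinear_prod: "bilinear_op scale (\<bullet>)"
    and linear_twist: "Vector_Spaces.linear scale scale \<alpha>"

locale comm_hom_associative_algebra = hom_algebra +
  assumes commute: "x \<bullet> y = y \<bullet> x"
    and hom_assoc: "(x \<bullet> y) \<bullet> \<alpha> z = \<alpha> x \<bullet> (y \<bullet> z)"

locale hom_novikov_algebra = hom_algebra +
  assumes left_symmetric:
      "(x \<bullet> y) \<bullet> \<alpha> z - \<alpha> x \<bullet> (y \<bullet> z) = (y \<bullet> x) \<bullet> \<alpha> z - \<alpha> y \<bullet> (x \<bullet> z)"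
    and right_commute: "(x \<bullet> y) \<bullet> \<alpha> z = (x \<bullet> z) \<bullet> \<alpha> y"

locale double_hom_algebra =
  dot: hom_algebra scale dot \<alpha> + ast: hom_algebra scale ast \<alpha>
  for scale :: "'k::field_char_0 \<Rightarrow> 'a::ab_group_add \<Rightarrow> 'a"
    and dot :: "'a \<Rightarrow> 'a \<Rightarrow> 'a" (infixl "\<cdot>" 70)
    and ast :: "'a \<Rightarrow> 'a \<Rightarrow> 'a" (infixl "\<^bold>*" 70)
    and \<alpha> :: "'a \<Rightarrow> 'a"

locale hom_novikov_poisson_algebra = double_hom_algebra +
  dot: comm_hom_associative_algebra scale dot \<alpha> +
  ast: hom_novikov_algebra scale ast \<alpha> +
  assumes left_compat:
      "(x \<^bold>* y) \<cdot> \<alpha> z - \<alpha> x \<^bold>* (y \<cdot> z) = (y \<^bold>* x) \<cdot> \<alpha> z - \<alpha> y \<^bold>* (x \<cdot> z)"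
    and right_compat: "(x \<cdot> y) \<^bold>* \<alpha> z = (x \<^bold>* z) \<cdot> \<alpha> y"

locale multiplicative_hom_novikov_poisson_algebra = hom_novikov_poisson_algebra +
  assumes twist_dot: "\<alpha> (x \<cdot> y) = \<alpha> x \<cdot> \<alpha> y"
    and twist_ast: "\<alpha> (x \<^bold>* y) = \<alpha> x \<^bold>* \<alpha> y"

end

theory Submission
  imports Defs
begin

text \<open>
  Multiplicativity pulls \<open>\<alpha>\<close> out of every product, and \<open>\<alpha>\<^sup>2(a) = a\<close>
  lets the factor \<open>a\<close> be moved through the twisted associative and compatibility laws
  without accumulating powers of \<open>\<alpha>\<close>. Expanding
  \<open>x \<times> y = \<alpha>(x) * \<alpha>(y) + a \<cdot> (x \<cdot> y)\<close> therefore splits each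
  axiom of the new algebra by the number of occurrences of \<open>a\<close>.
  Without \<open>a\<close>, what remains is the image under a power of \<open>\<alpha>\<close> of an axiom of
  \<open>A\<close>; the part quadratic in \<open>a\<close> is a product in the commutative Hom-associative
  algebra, hence symmetric in the three arguments. In the two compatibility axioms the
  linear part is such a product as well.

  Only the part linear in \<open>a\<close> of the two Novikov axioms needs an argument. The key
  observation is that \<open>(x * z) \<cdot> \<alpha>(y)\<close> equals both
  \<open>(x \<cdot> y) * \<alpha>(z)\<close> and \<open>(y * z) \<cdot> \<alpha>(x)\<close>
  (\<open>right_mult_slides\<close>): right multiplication by \<open>z\<close> may act on either
  factor of \<open>x \<cdot> y\<close>. Hence the linear part of
  \<open>(x \<times> y) \<times> \<alpha>\<^sup>2(z)\<close> can be written so as to be visibly symmetric in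
  \<open>y, z\<close> (\<open>deform_left_nested\<close>). For left symmetry, the same observation makes
  all linear terms symmetric in \<open>x, y\<close> except two:
  \<open>a \<cdot> \<alpha>((x * y) \<cdot> \<alpha>(z))\<close>, from
  \<open>(x \<times> y) \<times> \<alpha>\<^sup>2(z)\<close>, and
  \<open>\<alpha>\<^sup>3(x) * (\<alpha>(a) \<cdot> \<alpha>(y \<cdot> z))\<close>, from
  \<open>\<alpha>\<^sup>2(x) \<times> (y \<times> z)\<close>. Left compatibility of \<open>A\<close>, applied with
  \<open>\<alpha>(a)\<close> as one of the arguments, shows that these two have the same
  antisymmetrisation in \<open>x, y\<close> (\<open>antisym_ast_insert_fixed\<close>), so they cancel.
\<close>

section \<open>Bilinear operations\<close>

lemma bilinear_op_linear_right: "bilinear_op s f \<Longrightarrow> Vector_Spaces.linear s s (f x)"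
  by (simp add: bilinear_op_def)

lemma bilinear_opD:
  assumes "bilinear_op s f"
  shows "f (x + y) z = f x z + f y z" "f z (x + y) = f z x + f z y"
    "f (x - y) z = f x z - f y z" "f z (x - y) = f z x - f z y"
proof -
  have l: "Vector_Spaces.linear s s (\<lambda>x. f x z)" and r: "Vector_Spaces.linear s s (f z)"
    using assms by (auto simp: bilinear_op_def)
  interpret l: Vector_Spaces.linear s s "\<lambda>x. f x z" by (rule l)
  interpret r: Vector_Spaces.linear s s "f z" by (rule r)
  show "f (x + y) z = f x z + f y z" "f z (x + y) = f z x + f z y"
    "f (x - y) z = f x z - f y z" "f z (x - y) = f z x - f z y"
    by (rule l.add r.add l.diff r.diff)+
qed

lemma linear_plus:
  assumes f: "Vector_Spaces.linear s s f" and g: "Vector_Spaces.linear s s g"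
  shows "Vector_Spaces.linear s s (\<lambda>x. f x + g x)"
proof -
  interpret f: Vector_Spaces.linear s s f by (rule f)
  interpret vector_space_pair s s by unfold_locales
  show ?thesis by (rule linear_compose_add[OF f g])
qed

lemma linear_comp:
  assumes "Vector_Spaces.linear s s f" and "Vector_Spaces.linear s s g"
  shows "Vector_Spaces.linear s s (\<lambda>x. f (g x))"
  using Vector_Spaces.linear_compose[OF assms(2,1)] by (simp add: o_def)

lemma bilinear_op_linear_comp:
  assumes "bilinear_op s f" and "Vector_Spaces.linear s s g"
  shows "bilinear_op s (\<lambda>x y. g (f x y))"
  using assms linear_comp unfolding bilinear_op_def by blast

lemma bilinear_op_precomp:
  assumes f: "bilinear_op s f" and g: "Vector_Spaces.linear s s g"
  shows "bilinear_op s (\<lambda>x y. f (g x) (g y))"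
  using f linear_comp[OF _ g] unfolding bilinear_op_def
  by (auto intro: linear_comp[OF _ g, of "\<lambda>u. f u _"])

lemma bilinear_op_plus:
  assumes "bilinear_op s f" and "bilinear_op s g"
  shows "bilinear_op s (\<lambda>x y. f x y + g x y)"
  using assms linear_plus unfolding bilinear_op_def by blast

section \<open>Identities in multiplicative Hom-Novikov-Poisson algebras\<close>

context multiplicative_hom_novikov_poisson_algebra
begin

lemmas dot_distribs = bilinear_opD[OF dot.bilinear_prod]
lemmas ast_distribs = bilinear_opD[OF ast.bilinear_prod]

lemma twist_add: "\<alpha> (x + y) = \<alpha> x + \<alpha> y"
  and twist_diff: "\<alpha> (x - y) = \<alpha> x - \<alpha> y"
proof -
  interpret L: Vector_Spaces.linear scale scale \<alpha> by (rule dot.linear_twist)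
  show "\<alpha> (x + y) = \<alpha> x + \<alpha> y" "\<alpha> (x - y) = \<alpha> x - \<alpha> y"
    by (rule L.add L.diff)+
qed

lemma dot_left_commute: "\<alpha> x \<cdot> (y \<cdot> z) = \<alpha> y \<cdot> (x \<cdot> z)"
  by (metis dot.commute dot.hom_assoc)

text \<open>
  Both sides equal \<open>(x \<cdot> y) * \<alpha>(z)\<close>, which is symmetric in \<open>x, y\<close>
  because the dot product commutes.
\<close>

lemma right_mult_slides: "(x \<^bold>* z) \<cdot> \<alpha> y = (y \<^bold>* z) \<cdot> \<alpha> x"
  by (metis right_compat dot.commute)

end

section \<open>The deformed product\<close>

locale multiplicative_hom_novikov_poisson_fixed =
  multiplicative_hom_novikov_poisson_algebra +
  fixes a
  assumes twist_twist_fixed: "\<alpha> (\<alpha> a) = a"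
begin

definition deform (infixl "\<otimes>" 70)
  where "x \<otimes> y = \<alpha> x \<^bold>* \<alpha> y + a \<cdot> (x \<cdot> y)"

lemma twist_twist_fixed_dot: "\<alpha> (\<alpha> (a \<cdot> x)) = a \<cdot> \<alpha> (\<alpha> x)"
  by (simp add: twist_dot twist_twist_fixed)

text \<open>
  The factor \<open>\<alpha>(a)\<close> leaves the left argument of \<open>*\<close> as \<open>\<alpha>\<^sup>2(a) = a\<close>.
\<close>

lemma fixed_dot_ast: "(\<alpha> a \<cdot> \<alpha> w) \<^bold>* \<alpha> (\<alpha> (\<alpha> z)) = a \<cdot> \<alpha> (w \<^bold>* \<alpha> z)"
proof -
  have "(\<alpha> a \<cdot> \<alpha> w) \<^bold>* \<alpha> (\<alpha> (\<alpha> z)) = (\<alpha> w \<cdot> \<alpha> a) \<^bold>* \<alpha> (\<alpha> (\<alpha> z))"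
    by (simp only: dot.commute)
  also have "\<dots> = (\<alpha> w \<^bold>* \<alpha> (\<alpha> z)) \<cdot> a"
    by (simp only: right_compat twist_twist_fixed)
  also have "\<dots> = a \<cdot> \<alpha> (w \<^bold>* \<alpha> z)"
    by (simp only: twist_ast dot.commute)
  finally show ?thesis .
qed

text \<open>
  A normal form for the left-nested product in which \<open>a\<close> occurs only in outer dot factors
  \<open>a\<close>, \<open>\<alpha>(a)\<close>; the two summands of its linear part are exchanged by swapping \<open>y\<close> and
  \<open>z\<close>.
\<close>

lemma deform_left_nested:
  "(x \<otimes> y) \<otimes> \<alpha> (\<alpha> z) =
    \<alpha> (\<alpha> ((x \<^bold>* y) \<^bold>* \<alpha> z))
    + a \<cdot> \<alpha> ((x \<^bold>* z) \<cdot> \<alpha> y + (x \<^bold>* y) \<cdot> \<alpha> z)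
    + a \<cdot> (\<alpha> a \<cdot> ((x \<cdot> y) \<cdot> \<alpha> z))"
proof -
  have "(a \<cdot> (x \<cdot> y)) \<cdot> \<alpha> (\<alpha> z) = \<alpha> a \<cdot> ((x \<cdot> y) \<cdot> \<alpha> z)"
    by (rule dot.hom_assoc)
  moreover have "\<alpha> (a \<cdot> (x \<cdot> y)) \<^bold>* \<alpha> (\<alpha> (\<alpha> z)) = a \<cdot> \<alpha> ((x \<^bold>* z) \<cdot> \<alpha> y)"
    by (simp only: twist_dot[of a] fixed_dot_ast) (simp only: right_compat)
  ultimately show ?thesis
    by (simp add: deform_def twist_add dot_distribs ast_distribs twist_ast
        twist_dot[of "x \<^bold>* y"] add_ac)
qed

lemma deform_right_nested:
  "\<alpha> (\<alpha> x) \<otimes> (y \<otimes> z) =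
    \<alpha> (\<alpha> (\<alpha> x \<^bold>* (y \<^bold>* z)))
    + \<alpha> (\<alpha> (\<alpha> x)) \<^bold>* (\<alpha> a \<cdot> \<alpha> (y \<cdot> z))
    + a \<cdot> \<alpha> ((y \<^bold>* z) \<cdot> \<alpha> x)
    + a \<cdot> (\<alpha> a \<cdot> (\<alpha> x \<cdot> (y \<cdot> z)))"
proof -
  have "\<alpha> (\<alpha> x) \<cdot> (a \<cdot> (y \<cdot> z)) = \<alpha> a \<cdot> (\<alpha> x \<cdot> (y \<cdot> z))"
    by (rule dot_left_commute)
  moreover have "\<alpha> (\<alpha> x) \<cdot> (\<alpha> y \<^bold>* \<alpha> z) = \<alpha> ((y \<^bold>* z) \<cdot> \<alpha> x)"
    by (simp only: twist_dot twist_ast dot.commute)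
  ultimately show ?thesis
    by (simp add: deform_def twist_add dot_distribs ast_distribs twist_ast
        twist_dot[of a] add_ac)
qed

text \<open>
  Left compatibility exchanges \<open>\<alpha>\<^sup>2(x)\<close> with \<open>\<alpha>(a)\<close>. Of the three
  terms this produces, \<open>(\<alpha>\<^sup>2(x) * \<alpha>(a)) \<cdot> \<alpha>\<^sup>2(y \<cdot> z)\<close>
  and \<open>a * (\<alpha>\<^sup>2(x) \<cdot> \<alpha>(y \<cdot> z))\<close> are symmetric in
  \<open>x, y\<close>, and the remaining one is
  \<open>- a \<cdot> \<alpha>((y * x) \<cdot> \<alpha>(z))\<close>.
\<close>

lemma antisym_ast_insert_fixed:
  "\<alpha> (\<alpha> (\<alpha> x)) \<^bold>* (\<alpha> a \<cdot> \<alpha> (y \<cdot> z)) - \<alpha> (\<alpha> (\<alpha> y)) \<^bold>* (\<alpha> a \<cdot> \<alpha> (x \<cdot> z))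
    = a \<cdot> \<alpha> ((x \<^bold>* y) \<cdot> \<alpha> z) - a \<cdot> \<alpha> ((y \<^bold>* x) \<cdot> \<alpha> z)"
proof -
  have expand: "\<alpha> (\<alpha> (\<alpha> u)) \<^bold>* (\<alpha> a \<cdot> \<alpha> (v \<cdot> z))
      = (\<alpha> (\<alpha> u) \<^bold>* \<alpha> a) \<cdot> \<alpha> (\<alpha> (v \<cdot> z)) + a \<^bold>* (\<alpha> (\<alpha> u) \<cdot> \<alpha> (v \<cdot> z))
        - a \<cdot> \<alpha> ((v \<^bold>* u) \<cdot> \<alpha> z)" for u v
  proof -
    have "(\<alpha> a \<^bold>* \<alpha> (\<alpha> u)) \<cdot> \<alpha> (\<alpha> (v \<cdot> z)) = a \<cdot> \<alpha> ((v \<^bold>* u) \<cdot> \<alpha> z)"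
      by (simp only: right_compat[symmetric] fixed_dot_ast)
    then show ?thesis
      using left_compat[of "\<alpha> (\<alpha> u)" "\<alpha> a" "\<alpha> (v \<cdot> z)"]
      by (simp add: twist_twist_fixed algebra_simps)
  qed
  have swap: "\<alpha> (\<alpha> x) \<cdot> \<alpha> (y \<cdot> z) = \<alpha> (\<alpha> y) \<cdot> \<alpha> (x \<cdot> z)"
    using arg_cong[OF dot_left_commute[of x y z], of \<alpha>] by (simp only: twist_dot)
  have "(\<alpha> (\<alpha> x) \<^bold>* \<alpha> a) \<cdot> \<alpha> (\<alpha> (y \<cdot> z)) = (\<alpha> (\<alpha> y) \<^bold>* \<alpha> a) \<cdot> \<alpha> (\<alpha> (x \<cdot> z))"
    by (simp only: right_compat[symmetric] swap)
  then show ?thesis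
    by (simp add: expand swap)
qed

lemma deform_right_commute: "(x \<otimes> y) \<otimes> \<alpha> (\<alpha> z) = (x \<otimes> z) \<otimes> \<alpha> (\<alpha> y)"
proof -
  have "(x \<cdot> y) \<cdot> \<alpha> z = (x \<cdot> z) \<cdot> \<alpha> y"
    by (metis dot.hom_assoc dot.commute)
  then show ?thesis
    by (simp add: deform_left_nested ast.right_commute[of x y z] add.commute)
qed

lemma deform_left_symmetric:
  "(x \<otimes> y) \<otimes> \<alpha> (\<alpha> z) - \<alpha> (\<alpha> x) \<otimes> (y \<otimes> z)
    = (y \<otimes> x) \<otimes> \<alpha> (\<alpha> z) - \<alpha> (\<alpha> y) \<otimes> (x \<otimes> z)"
proof -
  have "\<alpha> (\<alpha> ((x \<^bold>* y) \<^bold>* \<alpha> z)) - \<alpha> (\<alpha> (\<alpha> x \<^bold>* (y \<^bold>* z)))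
      = \<alpha> (\<alpha> ((y \<^bold>* x) \<^bold>* \<alpha> z)) - \<alpha> (\<alpha> (\<alpha> y \<^bold>* (x \<^bold>* z)))"
    using ast.left_symmetric[of x y z] by (metis twist_diff)
  then show ?thesis
    using antisym_ast_insert_fixed[of x y z]
    unfolding deform_left_nested deform_right_nested
    by (simp add: twist_add dot_distribs right_mult_slides[of x z y] dot.commute[of x y]
        dot_left_commute[of x y z] algebra_simps)
qed

lemma deform_left_compat:
  "\<alpha> ((x \<otimes> y) \<cdot> \<alpha> (\<alpha> z)) - \<alpha> (\<alpha> x) \<otimes> \<alpha> (y \<cdot> z)
    = \<alpha> ((y \<otimes> x) \<cdot> \<alpha> (\<alpha> z)) - \<alpha> (\<alpha> y) \<otimes> \<alpha> (x \<cdot> z)"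
proof -
  have expand: "\<alpha> ((u \<otimes> v) \<cdot> \<alpha> (\<alpha> z)) - \<alpha> (\<alpha> u) \<otimes> \<alpha> (v \<cdot> z)
    = \<alpha> (\<alpha> ((u \<^bold>* v) \<cdot> \<alpha> z - \<alpha> u \<^bold>* (v \<cdot> z)))" for u v
  proof -
    have "\<alpha> ((a \<cdot> (u \<cdot> v)) \<cdot> \<alpha> (\<alpha> z)) = \<alpha> (\<alpha> a \<cdot> (\<alpha> u \<cdot> (v \<cdot> z)))"
      by (simp only: dot.hom_assoc)
    also have "\<dots> = a \<cdot> (\<alpha> (\<alpha> u) \<cdot> \<alpha> (v \<cdot> z))"
      by (simp only: twist_dot twist_twist_fixed)
    finally show ?thesis
      by (simp add: deform_def twist_add twist_diff dot_distribs twist_ast twist_dot)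
  qed
  show ?thesis
    by (simp only: expand left_compat)
qed

lemma deform_right_compat:
  "\<alpha> (x \<cdot> y) \<otimes> \<alpha> (\<alpha> z) = \<alpha> ((x \<otimes> z) \<cdot> \<alpha> (\<alpha> y))"
proof -
  have "\<alpha> ((a \<cdot> (x \<cdot> z)) \<cdot> \<alpha> (\<alpha> y)) = a \<cdot> \<alpha> ((x \<cdot> z) \<cdot> \<alpha> y)"
    by (simp only: dot.hom_assoc twist_dot twist_twist_fixed)
  also have "(x \<cdot> z) \<cdot> \<alpha> y = (x \<cdot> y) \<cdot> \<alpha> z"
    by (metis dot.hom_assoc dot.commute)
  finally have perturbation:
    "\<alpha> ((a \<cdot> (x \<cdot> z)) \<cdot> \<alpha> (\<alpha> y)) = a \<cdot> (\<alpha> (x \<cdot> y) \<cdot> \<alpha> (\<alpha> z))"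
    by (simp only: twist_dot)
  have "\<alpha> (\<alpha> ((x \<cdot> y) \<^bold>* \<alpha> z)) = \<alpha> (\<alpha> ((x \<^bold>* z) \<cdot> \<alpha> y))"
    by (simp only: right_compat)
  then have "\<alpha> (\<alpha> (x \<cdot> y)) \<^bold>* \<alpha> (\<alpha> (\<alpha> z)) = \<alpha> ((\<alpha> x \<^bold>* \<alpha> z) \<cdot> \<alpha> (\<alpha> y))"
    by (simp only: twist_ast twist_dot)
  with perturbation show ?thesis
    by (simp add: deform_def twist_add dot_distribs)
qed

lemma linear_twist_twist: "Vector_Spaces.linear scale scale (\<lambda>x. \<alpha> (\<alpha> x))"
  by (rule linear_comp[OF dot.linear_twist dot.linear_twist])

lemma bilinear_deform: "bilinear_op scale (\<otimes>)"
proof -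
  have left_mult: "Vector_Spaces.linear scale scale ((\<cdot>) a)"
    by (rule bilinear_op_linear_right[OF dot.bilinear_prod])
  have "bilinear_op scale (\<lambda>x y. \<alpha> x \<^bold>* \<alpha> y)"
    by (rule bilinear_op_precomp[OF ast.bilinear_prod dot.linear_twist])
  moreover have "bilinear_op scale (\<lambda>x y. a \<cdot> (x \<cdot> y))"
    by (rule bilinear_op_linear_comp[OF dot.bilinear_prod left_mult])
  ultimately have "bilinear_op scale (\<lambda>x y. \<alpha> x \<^bold>* \<alpha> y + a \<cdot> (x \<cdot> y))"
    by (rule bilinear_op_plus)
  then show ?thesis
    by (simp only: deform_def[abs_def])
qed

theorem deformed_algebra:
  "multiplicative_hom_novikov_poisson_algebra scale (\<lambda>x y. \<alpha> (x \<cdot> y)) (\<otimes>) (\<lambda>x. \<alpha> (\<alpha> x))"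
proof -
  let ?dot = "\<lambda>x y. \<alpha> (x \<cdot> y)" and ?twist = "\<lambda>x. \<alpha> (\<alpha> x)"
  have "hom_algebra scale ?dot ?twist"
    by (intro hom_algebra.intro hom_algebra_axioms.intro dot.vector_space_axioms
        bilinear_op_linear_comp[OF dot.bilinear_prod dot.linear_twist] linear_twist_twist)
  moreover have "hom_algebra scale (\<otimes>) ?twist"
    by (intro hom_algebra.intro hom_algebra_axioms.intro dot.vector_space_axioms
        bilinear_deform linear_twist_twist)
  moreover have "comm_hom_associative_algebra_axioms ?dot ?twist"
    by (rule comm_hom_associative_algebra_axioms.intro)
      (simp only: dot.commute, simp only: twist_dot[symmetric] dot.hom_assoc)
  moreover have "hom_novikov_algebra_axioms (\<otimes>) ?twist"
    by (rule hom_novikov_algebra_axioms.intro) (rule deform_left_symmetric deform_right_commute)+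
  ultimately have "hom_novikov_poisson_algebra scale ?dot (\<otimes>) ?twist"
    by (intro hom_novikov_poisson_algebra.intro hom_novikov_poisson_algebra_axioms.intro
        double_hom_algebra.intro comm_hom_associative_algebra.intro hom_novikov_algebra.intro
        deform_left_compat deform_right_compat)
  then show ?thesis
    by (rule multiplicative_hom_novikov_poisson_algebra.intro)
      (rule multiplicative_hom_novikov_poisson_algebra_axioms.intro,
        simp_all add: deform_def twist_add twist_ast twist_dot twist_twist_fixed)
qed

end

section \<open>The deformed Hom-Novikov-Poisson algebra\<close>

theorem theorem4p4:
  fixes scale :: "'k::field_char_0 \<Rightarrow> 'a::ab_group_add \<Rightarrow> 'a"
    and dot :: "'a \<Rightarrow> 'a \<Rightarrow> 'a" (infixl "\<cdot>" 70)
    and ast :: "'a \<Rightarrow> 'a \<Rightarrow> 'a" (infixl "\<^bold>*" 70)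
    and \<alpha> :: "'a \<Rightarrow> 'a"
    and a :: 'a
  assumes "multiplicative_hom_novikov_poisson_algebra scale (\<cdot>) (\<^bold>*) \<alpha>"
    and "(\<alpha> ^^ 2) a = a"
  shows "(\<forall>x y. \<alpha> (x \<cdot> y) = \<alpha> x \<cdot> \<alpha> y) \<and>
    multiplicative_hom_novikov_poisson_algebra scale
      (\<lambda>x y. \<alpha> (x \<cdot> y))
      (\<lambda>x y. (\<alpha> x \<^bold>* \<alpha> y) + a \<cdot> (x \<cdot> y))
      (\<alpha> ^^ 2)"
proof -
  interpret multiplicative_hom_novikov_poisson_algebra scale "(\<cdot>)" "(\<^bold>*)" \<alpha>
    by (rule assms(1))
  interpret multiplicative_hom_novikov_poisson_fixed scale "(\<cdot>)" "(\<^bold>*)" \<alpha> a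
    using assms by (intro multiplicative_hom_novikov_poisson_fixed.intro
        multiplicative_hom_novikov_poisson_fixed_axioms.intro) (simp_all add: numeral_2_eq_2)
  have "\<alpha> ^^ 2 = (\<lambda>x. \<alpha> (\<alpha> x))"
    by (simp add: numeral_2_eq_2 fun_eq_iff)
  then show ?thesis
    using deformed_algebra twist_dot by (simp add: deform_def[abs_def])
qed

end
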